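(* Let $f:\Omega_n\to\mathbb R$ be a random variable on $\Omega_n=\{a,b\}^{W}$. Then $$\operatorname{var}(f)=\sum_{M\subseteq W,\ M\neq\emptyset}\left(p(1-p)\right)^{|M|}\left(\mathbb E\left[\partial_Mf\right]\right)^2 .$$
   Context: Fix $d\ge 2$, real numbers $0<a<b$, $p\in(0,1)$ and $n\in\mathbb N$. $W=W_n$ is the finite edge set of the graph with vertex set $\mathbb Z^d\cap[-2n,2n]^d$ in which $x,y$ are adjacent iff $\sum_i|x_i-y_i|=1$. The sample space $\Omega=\Omega_n=\{a,b\}^{W}$ carries the product measure $\mathbb P$ under which the coordinates $\omega_e$ ($e\in W$) are independent with $\mathbb P(\omega_e=a)=p$, $\mathbb P(\omega_e=b)=1-p$; $\mathbb E$ and $\operatorname{var}$ are taken with respect to $\mathbb P$. For $j\in W$ and $\delta\in\{a,b\}$, $\sigma_j^\delta:\Omega\to\Omega$ replaces the coordinate $\omega_j$ by $\delta$ and leaves the other coordinates unchanged. For $\varphi:\Omega\to\mathbb R$, $\partial_j\varphi=\varphi\circ\sigma_j^b-\varphi\circ\sigma_j^a$. For nonempty $S=\{s_1,\dots,s_m\}\subseteq W$ with distinct $s_i$, $\partial_S\varphi=\partial_{s_1}\cdots\partial_{s_m}\varphi$ (independent of the order). *)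

theory Defs
  imports "HOL-Probability.Probability"
begin

type_synonym 'd site = "int ^ 'd"
type_synonym 'd edge = "'d site set"
type_synonym 'd config = "'d edge \<Rightarrow> real"

definition box :: "nat \<Rightarrow> ('d::finite) site set" where
  "box n = {x. \<forall>i. - 2 * int n \<le> x $ i \<and> x $ i \<le> 2 * int n}"

text \<open>Edges are undirected: the edge between adjacent sites \<open>x\<close> and \<open>y\<close> is the set \<open>{x, y}\<close>.\<close>

definition edges :: "nat \<Rightarrow> ('d::finite) edge set" where
  "edges n = {{x, y} | x y. x \<in> box n \<and> y \<in> box n \<and> (\<Sum>i\<in>UNIV. \<bar>x $ i - y $ i\<bar>) = 1}"

text \<open>
  Configurations are total functions that take the value \<^term>\<open>undefined\<close> off \<open>edges n\<close>.
  The default value in the product measure is chosen accordingly, so that its support is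
  exactly the sample space (lemma \<open>set_pmf_config_pmf\<close> below).
\<close>

definition configs :: "real \<Rightarrow> real \<Rightarrow> nat \<Rightarrow> ('d::finite) config set" where
  "configs a b n = edges n \<rightarrow>\<^sub>E {a, b}"

definition config_pmf :: "real \<Rightarrow> real \<Rightarrow> real \<Rightarrow> nat \<Rightarrow> ('d::finite) config pmf" where
  "config_pmf a b p n =
     Pi_pmf (edges n) undefined (\<lambda>_. map_pmf (\<lambda>t. if t then a else b) (bernoulli_pmf p))"

definition set_edge :: "'d edge \<Rightarrow> real \<Rightarrow> ('d::finite) config \<Rightarrow> 'd config" where
  "set_edge j \<delta> \<omega> = fun_upd \<omega> j \<delta>"

definition pdiff ::
  "real \<Rightarrow> real \<Rightarrow> 'd edge \<Rightarrow> (('d::finite) config \<Rightarrow> real) \<Rightarrow> 'd config \<Rightarrow> real" where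
  "pdiff a b j \<phi> = (\<lambda>\<omega>. (\<phi> \<circ> set_edge j b) \<omega> - (\<phi> \<circ> set_edge j a) \<omega>)"

text \<open>
  The operators \<open>pdiff a b j\<close> commute, so folding them over a finite set is the composition
  in any order (lemma \<open>pdiff_set_distinct\<close> below).
\<close>

definition pdiff_set ::
  "real \<Rightarrow> real \<Rightarrow> 'd edge set \<Rightarrow> (('d::finite) config \<Rightarrow> real) \<Rightarrow> 'd config \<Rightarrow> real" where
  "pdiff_set a b S \<phi> = Finite_Set.fold (pdiff a b) \<phi> S"

lemma pdiff_commute: "pdiff a b i (pdiff a b j \<phi>) = pdiff a b j (pdiff a b i \<phi>)"
  by (cases "i = j") (auto simp: pdiff_def set_edge_def fun_eq_iff fun_upd_twist)

interpretation pdiff: comp_fun_commute "pdiff a b"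
  by standard (auto simp: fun_eq_iff pdiff_commute)

lemma pdiff_set_distinct:
  assumes "distinct js"
  shows "pdiff_set a b (set js) \<phi> = foldr (pdiff a b) js \<phi>"
  using assms by (induction js) (simp_all add: pdiff_set_def)

lemma finite_box: "finite (box n :: ('d::finite) site set)"
proof -
  have "box n \<subseteq> vec_lambda ` ((UNIV :: 'd set) \<rightarrow>\<^sub>E {- 2 * int n..2 * int n})"
  proof
    fix x :: "'d site" assume "x \<in> box n"
    then have "vec_nth x \<in> UNIV \<rightarrow>\<^sub>E {- 2 * int n..2 * int n}"
      by (auto simp: box_def PiE_iff)
    then show "x \<in> vec_lambda ` (UNIV \<rightarrow>\<^sub>E {- 2 * int n..2 * int n})"
      by (metis image_eqI vec_nth_inverse)
  qed
  then show ?thesis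
    by (rule finite_subset) (intro finite_imageI finite_PiE; simp)
qed

lemma finite_edges: "finite (edges n :: ('d::finite) edge set)"
proof (rule finite_subset)
  show "edges n \<subseteq> Pow (box n :: 'd site set)"
    by (auto simp: edges_def)
qed (simp add: finite_box)

lemma set_pmf_config_pmf:
  assumes "0 < p" "p < 1"
  shows "set_pmf (config_pmf a b p n :: ('d::finite) config pmf) = configs a b n"
proof -
  have "set_pmf (map_pmf (\<lambda>t. if t then a else b) (bernoulli_pmf p)) = {a, b}"
    using assms by (auto simp: UNIV_bool)
  then show ?thesis
    by (simp add: config_pmf_def configs_def set_Pi_pmf finite_edges PiE_dflt_def PiE_def
        extensional_def Pi_def set_eq_iff) blast
qed

end

theory Submission
  imports Defs
begin

text \<open>
  The identity is Parseval's formula for the product of biased two-point spaces. For one edge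
  with values \<open>x\<close> (of probability \<open>p\<close>) and \<open>y\<close> (of probability \<open>1 - p\<close>) it says
  \<open>p x\<^sup>2 + (1 - p) y\<^sup>2 = (p x + (1 - p) y)\<^sup>2 + p (1 - p) (y - x)\<^sup>2\<close>: the second moment is the squared mean plus \<open>p (1 - p)\<close> times the squared increment.

  Averaging over the edge \<open>e\<close> alone is an operator, \<open>avg_edge a b p e\<close> below. It commutes with
  \<open>\<partial>\<^sub>j\<close> for \<open>j \<noteq> e\<close>, and it fixes \<open>\<partial>\<^sub>e f\<close>, which no longer depends on \<open>\<omega>\<^sub>e\<close>. Integrating
  out one edge at a time (\<open>expectation_insert_edge\<close>) and applying the one-edge identity at each
  step therefore splits the second moment of \<open>f\<close> into a part with \<open>f\<close> averaged in \<open>e\<close> and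
  a part with \<open>\<partial>\<^sub>e f\<close>. Iterating over all edges, every set \<open>M\<close> of edges arises exactly once,
  as the set of edges where the increment was chosen; this is \<open>second_moment_expansion\<close>. The
  term \<open>M = {}\<close> is the squared mean, and moving it to the other side leaves the variance.
\<close>

definition edge_pmf :: "real \<Rightarrow> real \<Rightarrow> real \<Rightarrow> 'd edge set \<Rightarrow> ('d::finite) config pmf" where
  "edge_pmf a b p A =
     Pi_pmf A undefined (\<lambda>_. map_pmf (\<lambda>t. if t then a else b) (bernoulli_pmf p))"

definition avg_edge ::
  "real \<Rightarrow> real \<Rightarrow> real \<Rightarrow> 'd edge \<Rightarrow> (('d::finite) config \<Rightarrow> real) \<Rightarrow> 'd config \<Rightarrow> real" where
  "avg_edge a b p e f = (\<lambda>\<omega>. p * f (set_edge e a \<omega>) + (1 - p) * f (set_edge e b \<omega>))"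

lemma finite_set_edge_pmf:
  assumes "finite A"
  shows "finite (set_pmf (edge_pmf a b p A))"
  unfolding edge_pmf_def set_Pi_pmf[OF assms]
  by (rule finite_PiE_dflt) (use assms in \<open>auto intro: finite_subset[OF subset_UNIV]\<close>)

lemma integrable_edge_pmf:
  fixes f :: "('d::finite) config \<Rightarrow> real"
  shows "finite A \<Longrightarrow> integrable (measure_pmf (edge_pmf a b p A)) f"
  by (intro integrable_measure_pmf_finite finite_set_edge_pmf)

lemma expectation_insert_edge:
  fixes f :: "('d::finite) config \<Rightarrow> real"
  assumes "finite A" "e \<notin> A" "0 \<le> p" "p \<le> 1"
  shows "measure_pmf.expectation (edge_pmf a b p (insert e A)) f =
    measure_pmf.expectation (edge_pmf a b p A) (avg_edge a b p e f)"
proof -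
  have "edge_pmf a b p (insert e A) =
      bernoulli_pmf p \<bind> (\<lambda>t. map_pmf (set_edge e (if t then a else b)) (edge_pmf a b p A))"
    unfolding edge_pmf_def
    by (simp add: Pi_pmf_insert'[OF assms(1,2)] map_pmf_def bind_assoc_pmf bind_return_pmf
        set_edge_def)
  then have "measure_pmf.expectation (edge_pmf a b p (insert e A)) f =
      (\<Sum>t\<in>UNIV. pmf (bernoulli_pmf p) t *\<^sub>R measure_pmf.expectation
        (map_pmf (set_edge e (if t then a else b)) (edge_pmf a b p A)) f)"
    using pmf_expectation_bind[of UNIV
        "\<lambda>t. map_pmf (set_edge e (if t then a else b)) (edge_pmf a b p A)" "bernoulli_pmf p" f]
    by (simp add: finite_set_edge_pmf[OF assms(1)])
  also have "\<dots> = measure_pmf.expectation (edge_pmf a b p A) (avg_edge a b p e f)"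
    using assms(3,4) by (simp add: UNIV_bool avg_edge_def integrable_edge_pmf[OF assms(1)])
  finally show ?thesis .
qed

lemma pdiff_set_empty: "pdiff_set a b {} f = f"
  by (simp add: pdiff_set_def)

lemma pdiff_set_insert:
  assumes "finite M" "e \<notin> M"
  shows "pdiff_set a b (insert e M) f = pdiff a b e (pdiff_set a b M f)"
  using assms by (simp add: pdiff_set_def)

lemma pdiff_set_insert_inner:
  assumes "finite M" "e \<notin> M"
  shows "pdiff_set a b (insert e M) f = pdiff_set a b M (pdiff a b e f)"
  using assms by (simp add: pdiff_set_def pdiff.fold_fun_left_comm)

lemma avg_edge_pdiff_commute:
  assumes "j \<noteq> e"
  shows "avg_edge a b p e (pdiff a b j f) = pdiff a b j (avg_edge a b p e f)"
  using assms
  by (simp add: avg_edge_def pdiff_def set_edge_def fun_upd_twist[OF assms] algebra_simps)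

lemma avg_edge_pdiff_same: "avg_edge a b p e (pdiff a b e f) = pdiff a b e f"
  by (simp add: avg_edge_def pdiff_def set_edge_def algebra_simps)

lemma avg_edge_pdiff_set:
  assumes "finite M" "e \<notin> M"
  shows "avg_edge a b p e (pdiff_set a b M f) = pdiff_set a b M (avg_edge a b p e f)"
  using assms
proof (induction M rule: finite_induct)
  case empty
  show ?case by (simp add: pdiff_set_empty)
next
  case (insert j M)
  then have "j \<noteq> e" by auto
  with insert show ?case
    by (simp add: pdiff_set_insert avg_edge_pdiff_commute)
qed

text \<open>The one-edge case of Parseval's formula.\<close>

lemma avg_edge_square:
  "avg_edge a b p e (\<lambda>\<omega>. (f \<omega>)\<^sup>2) \<omega> =
    (avg_edge a b p e f \<omega>)\<^sup>2 + p * (1 - p) * (pdiff a b e f \<omega>)\<^sup>2"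
  by (simp add: avg_edge_def pdiff_def power2_eq_square algebra_simps)

lemma sum_subsets_insert:
  fixes g :: "'b set \<Rightarrow> real"
  assumes "finite A" "e \<notin> A"
  shows "(\<Sum>M\<in>Pow (insert e A). g M) = (\<Sum>M\<in>Pow A. g M) + (\<Sum>M\<in>Pow A. g (insert e M))"
proof -
  have "inj_on (insert e) (Pow A)"
    using assms(2) by (auto simp: inj_on_def insert_eq_iff dest: subsetD)
  moreover have "Pow A \<inter> insert e ` Pow A = {}"
    using assms(2) by blast
  ultimately show ?thesis
    using assms(1) by (simp add: Pow_insert sum.union_disjoint sum.reindex)
qed

text \<open>
  Integrating out a further edge \<open>e\<close> replaces \<open>f\<close> by its average in \<open>e\<close> and, with weight
  \<open>p (1 - p)\<close>, by its increment in \<open>e\<close>; these two give the sets \<open>M\<close> without and with \<open>e\<close>.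
  The induction needs \<open>f\<close> to be arbitrary, as it is applied to both new functions.
\<close>

lemma second_moment_expansion:
  fixes f :: "('d::finite) config \<Rightarrow> real"
  assumes "finite A" "0 \<le> p" "p \<le> 1"
  shows "measure_pmf.expectation (edge_pmf a b p A) (\<lambda>\<omega>. (f \<omega>)\<^sup>2) =
    (\<Sum>M\<in>Pow A. (p * (1 - p)) ^ card M *
      (measure_pmf.expectation (edge_pmf a b p A) (pdiff_set a b M f))\<^sup>2)"
  using assms(1)
proof (induction A arbitrary: f rule: finite_induct)
  case empty
  show ?case by (simp add: edge_pmf_def pdiff_set_empty)
next
  case (insert e A)
  let ?E = "measure_pmf.expectation (edge_pmf a b p A)"
  let ?E' = "measure_pmf.expectation (edge_pmf a b p (insert e A))"
  let ?c = "p * (1 - p)"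
  note integrate_out = expectation_insert_edge[OF insert.hyps assms(2,3)]
  have subset: "finite M" "e \<notin> M" if "M \<in> Pow A" for M
    using that insert.hyps finite_subset[of M A] by auto
  have without: "?E (pdiff_set a b M (avg_edge a b p e f)) = ?E' (pdiff_set a b M f)"
    if "M \<in> Pow A" for M
    using subset[OF that] by (simp add: integrate_out avg_edge_pdiff_set)
  have with_e: "?E (pdiff_set a b M (pdiff a b e f)) = ?E' (pdiff_set a b (insert e M) f)"
    if "M \<in> Pow A" for M
    using subset[OF that]
    by (simp add: integrate_out pdiff_set_insert_inner avg_edge_pdiff_set avg_edge_pdiff_same)
  have power: "?c ^ card (insert e M) = ?c * ?c ^ card M" if "M \<in> Pow A" for M
    using subset[OF that] by simp
  have "?E' (\<lambda>\<omega>. (f \<omega>)\<^sup>2) =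
      ?E (\<lambda>\<omega>. (avg_edge a b p e f \<omega>)\<^sup>2 + ?c * (pdiff a b e f \<omega>)\<^sup>2)"
    unfolding integrate_out avg_edge_square ..
  also have "\<dots> = ?E (\<lambda>\<omega>. (avg_edge a b p e f \<omega>)\<^sup>2) + ?c * ?E (\<lambda>\<omega>. (pdiff a b e f \<omega>)\<^sup>2)"
    by (simp add: integrable_edge_pmf[OF insert.hyps(1)])
  also have "\<dots> = (\<Sum>M\<in>Pow A. ?c ^ card M * (?E' (pdiff_set a b M f))\<^sup>2) +
      (\<Sum>M\<in>Pow A. ?c ^ card (insert e M) * (?E' (pdiff_set a b (insert e M) f))\<^sup>2)"
    unfolding insert.IH sum_distrib_left
    by (intro arg_cong2[where f = "(+)"] sum.cong refl)
      (simp_all only: without with_e power mult.assoc)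
  also have "\<dots> = (\<Sum>M\<in>Pow (insert e A). ?c ^ card M * (?E' (pdiff_set a b M f))\<^sup>2)"
    using sum_subsets_insert[OF insert.hyps] by simp
  finally show ?case .
qed

theorem theorem1:
  fixes a b p :: real and n :: nat
    and f :: "('d::finite) config \<Rightarrow> real"
  assumes "CARD('d) \<ge> 2" and "0 < a" and "a < b" and "0 < p" and "p < 1"
  shows "measure_pmf.variance (config_pmf a b p n) f =
    (\<Sum>M | M \<subseteq> edges n \<and> M \<noteq> {}.
       (p * (1 - p)) ^ card M * (measure_pmf.expectation (config_pmf a b p n) (pdiff_set a b M f))\<^sup>2)"
proof -
  let ?W = "edges n :: 'd edge set"
  let ?E = "measure_pmf.expectation (edge_pmf a b p ?W)"
  let ?g = "\<lambda>M. (p * (1 - p)) ^ card M * (?E (pdiff_set a b M f))\<^sup>2"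
  have config: "config_pmf a b p n = edge_pmf a b p ?W"
    by (simp add: config_pmf_def edge_pmf_def)
  have nonempty: "{M. M \<subseteq> ?W \<and> M \<noteq> {}} = Pow ?W - {{}}"
    by auto
  have "measure_pmf.variance (edge_pmf a b p ?W) f = ?E (\<lambda>\<omega>. (f \<omega>)\<^sup>2) - (?E f)\<^sup>2"
    by (intro measure_pmf.variance_eq integrable_edge_pmf finite_edges)
  also have "?E (\<lambda>\<omega>. (f \<omega>)\<^sup>2) = (\<Sum>M\<in>Pow ?W. ?g M)"
    using assms by (intro second_moment_expansion finite_edges) auto
  also have "\<dots> = ?g {} + (\<Sum>M\<in>Pow ?W - {{}}. ?g M)"
    by (intro sum.remove) (auto simp: finite_edges)
  also have "?g {} = (?E f)\<^sup>2"
    by (simp add: pdiff_set_empty)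
  finally show ?thesis
    by (simp add: config nonempty)
qed

end
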